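(* Let $q$ be an odd prime power, $d\ge2$, $Q$ a nondegenerate quadratic form on $\mathbb F_q^d$. Let $P\subseteq\mathbb F_q^d$ be nonempty, let $\mathcal S$ be a nonempty family of distinct $Q$-spheres, and let $K>0$. Assume $$\sigma(P,\mathcal S)\ge Kq^{(d-1)/2}\sqrt{|P||\mathcal S|}.$$ Let $0<\varepsilon\le1$ and suppose $$\varepsilon^2K^2q^{d-1}|\mathcal S|\ge4|P|.$$ Then $P$ has a partition $P=R_1\sqcup\cdots\sqcup R_T\sqcup P_{\mathrm{rem}}$ with the following properties. (1) For every $j$ there is a nonconcentric pair $(S_j,S_j')\in\mathcal S^2$ such that $$R_j\subseteq P_{\mathrm{pos}}\cap S_j\cap S_j',\qquad|R_j|\ge\frac{\varepsilon^2K^2q^{d-1}}{4|\mathcal S|}.$$ (2) $\sigma(R_j)>0$ for every $j$. (3) The number of pieces satisfies $$T\le\frac{4|P||\mathcal S|}{\varepsilon^2K^2q^{d-1}}.$$ (4) $\sigma(P_{\mathrm{rem}})<\varepsilon\,\sigma(P,\mathcal S)$ and $$\sum_{j=1}^T\sigma(R_j)>(1-\varepsilon)\sigma(P,\mathcal S).$$ If $|\mathcal S|\le C_1Kq^{(d-1)/2}$, then every piece $R_j$ has size at least $\dfrac{\varepsilon^2Kq^{(d-1)/2}}{4C_1}$.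
   Context: For $c\in\mathbb F_q^d$, $r\in\mathbb F_q$ the $Q$-sphere is $S_Q(c,r)=\{x\in\mathbb F_q^d:Q(x-c)=r\}$; spheres are parametrized by pairs $(c,r)$ and distinct spheres means distinct parameter pairs. Two spheres are nonconcentric if their centers differ. $\sigma(P,\mathcal S)=|\{(p,S)\in P\times\mathcal S:p\in S\}|-|P||\mathcal S|/q$. For $p\in\mathbb F_q^d$, $d_{\mathcal S}(p)=|\{S\in\mathcal S:p\in S\}|$ and $e_{\mathcal S}(p)=d_{\mathcal S}(p)-|\mathcal S|/q$. $P_{\mathrm{pos}}=\{p\in P:e_{\mathcal S}(p)>0\}$, and for $A\subseteq P$, $\sigma(A)=\sum_{p\in A}e_{\mathcal S}(p)=\sigma(A,\mathcal S)$. *)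

theory Defs
  imports "HOL-Analysis.Analysis"
begin

text \<open>
  The field \<open>\<F>\<^sub>q\<close> is a type \<open>'a\<close> of classes \<open>field\<close> and \<open>finite\<close>, with \<open>q = CARD('a)\<close>, and
  \<open>\<F>\<^sub>q\<^sup>d\<close> is \<open>'a ^ 'n\<close> with \<open>d = CARD('n)\<close>.
\<close>

definition polar_form :: "('a::field ^ 'n::finite \<Rightarrow> 'a) \<Rightarrow> 'a ^ 'n \<Rightarrow> 'a ^ 'n \<Rightarrow> 'a" where
  "polar_form Q x y = Q (x + y) - Q x - Q y"

text \<open>The polar form is symmetric, so linearity in one argument makes it bilinear.\<close>

definition quadratic_form :: "('a::field ^ 'n::finite \<Rightarrow> 'a) \<Rightarrow> bool" where
  "quadratic_form Q \<longleftrightarrow>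
     (\<forall>c x. Q (c *s x) = c\<^sup>2 * Q x) \<and>
     (\<forall>x. Vector_Spaces.linear (*s) (*) (polar_form Q x))"

text \<open>Trivial radical of the polar form; this is the usual notion when \<open>2 \<noteq> 0\<close> in the field.\<close>

definition nondegenerate :: "('a::field ^ 'n::finite \<Rightarrow> 'a) \<Rightarrow> bool" where
  "nondegenerate Q \<longleftrightarrow> (\<forall>x. (\<forall>y. polar_form Q x y = 0) \<longrightarrow> x = 0)"

text \<open>
  A sphere is represented by its parameter pair (center, radius), so that a family of distinct
  spheres is a set of parameter pairs; \<open>qsphere\<close> is the point set of such a pair.
\<close>

definition qsphere :: "('a::field ^ 'n::finite \<Rightarrow> 'a) \<Rightarrow> ('a ^ 'n) \<times> 'a \<Rightarrow> ('a ^ 'n) set" where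
  "qsphere Q s = {x. Q (x - fst s) = snd s}"

definition nonconcentric :: "('a ^ 'n) \<times> 'a \<Rightarrow> ('a ^ 'n) \<times> 'a \<Rightarrow> bool" where
  "nonconcentric s s' \<longleftrightarrow> fst s \<noteq> fst s'"

definition surplus ::
  "('a::{field,finite} ^ 'n::finite \<Rightarrow> 'a) \<Rightarrow> ('a ^ 'n) set \<Rightarrow> (('a ^ 'n) \<times> 'a) set \<Rightarrow> real" where
  "surplus Q P \<S> =
     real (card {(p, s). p \<in> P \<and> s \<in> \<S> \<and> p \<in> qsphere Q s})
       - real (card P) * real (card \<S>) / real CARD('a)"

definition sphere_degree ::
  "('a::field ^ 'n::finite \<Rightarrow> 'a) \<Rightarrow> (('a ^ 'n) \<times> 'a) set \<Rightarrow> 'a ^ 'n \<Rightarrow> nat" where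
  "sphere_degree Q \<S> p = card {s \<in> \<S>. p \<in> qsphere Q s}"

definition excess ::
  "('a::{field,finite} ^ 'n::finite \<Rightarrow> 'a) \<Rightarrow> (('a ^ 'n) \<times> 'a) set \<Rightarrow> 'a ^ 'n \<Rightarrow> real" where
  "excess Q \<S> p = real (sphere_degree Q \<S> p) - real (card \<S>) / real CARD('a)"

definition pos_points ::
  "('a::{field,finite} ^ 'n::finite \<Rightarrow> 'a) \<Rightarrow> ('a ^ 'n) set \<Rightarrow> (('a ^ 'n) \<times> 'a) set \<Rightarrow> ('a ^ 'n) set" where
  "pos_points Q P \<S> = {p \<in> P. excess Q \<S> p > 0}"

lemma surplus_eq_sum_excess:
  fixes Q :: "'a::{field,finite} ^ 'n::finite \<Rightarrow> 'a"
  shows "surplus Q A \<S> = (\<Sum>p\<in>A. excess Q \<S> p)"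
proof -
  have "{(p, s). p \<in> A \<and> s \<in> \<S> \<and> p \<in> qsphere Q s} = (SIGMA p:A. {s \<in> \<S>. p \<in> qsphere Q s})"
    by auto
  then show ?thesis
    by (simp add: surplus_def excess_def sphere_degree_def sum_subtractf)
qed

end

theory Submission
  imports Defs
begin

text \<open>
  Greedy extraction.  Suppose a remainder \<open>A \<subseteq> P\<close> still has surplus at least \<open>\<epsilon> \<sigma>(P, \<S>)\<close>, and
  keep only its points \<open>M\<close> of positive excess.  Their degree sum \<open>D\<close> is then at least the
  surplus, so \<open>D \<ge> 2 |M|\<close>.  By Cauchy-Schwarz the sum of \<open>|M \<inter> S \<inter> S'|\<close> over all pairs of spheres is
  at least \<open>D\<^sup>2 / |M|\<close>; distinct concentric spheres are disjoint, so concentric pairs contribute only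
  \<open>D \<le> D\<^sup>2 / (2 |M|)\<close>, and the average over the nonconcentric pairs yields a rich pair.  Remove its
  points and repeat.
\<close>

lemma greedy_extraction:
  fixes f :: "'b \<Rightarrow> real"
  assumes "finite A"
    and step: "\<forall>B\<subseteq>A. t \<le> sum f B \<longrightarrow> (\<exists>R\<subseteq>B. R \<noteq> {} \<and> good R)"
  shows "\<exists>(T::nat) R A_rem. A = (\<Union>j\<in>{1..T}. R j) \<union> A_rem \<and> disjoint_family_on R {1..T} \<and>
           (\<forall>j\<in>{1..T}. R j \<inter> A_rem = {} \<and> R j \<noteq> {} \<and> good (R j)) \<and> sum f A_rem < t"
  using assms
\<comment> \<open>A removed piece is nonempty, so what is left is a strictly smaller set; the
  induction hypothesis splits it and the removed piece is added back.\<close>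
proof (induction A rule: finite_psubset_induct)
  case (psubset A)
  show ?case
  proof (cases "sum f A < t")
    case True
    \<comment> \<open>With \<open>T = 0\<close> the index set \<open>{1..0}\<close> is empty and all
      of \<open>A\<close> is remainder.\<close>
    then show ?thesis
      by (intro exI[of _ 0] exI[of _ "\<lambda>_. {}"] exI[of _ A]) (auto simp: disjoint_family_on_def)
  next
    case False
    then obtain R0 where R0: "R0 \<subseteq> A" "R0 \<noteq> {}" "good R0"
      using psubset.prems by (meson not_less order_refl)
    have "\<forall>B\<subseteq>A - R0. t \<le> sum f B \<longrightarrow> (\<exists>R\<subseteq>B. R \<noteq> {} \<and> good R)"
      using psubset.prems by blast
    moreover have "A - R0 \<subset> A" using R0 by blast
    ultimately have "\<exists>(T::nat) R A_rem. A - R0 = (\<Union>j\<in>{1..T}. R j) \<union> A_rem \<and>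
        disjoint_family_on R {1..T} \<and>
        (\<forall>j\<in>{1..T}. R j \<inter> A_rem = {} \<and> R j \<noteq> {} \<and> good (R j)) \<and> sum f A_rem < t"
      by (intro psubset.IH)
    then obtain T :: nat and R A_rem where IH: "A - R0 = (\<Union>j\<in>{1..T}. R j) \<union> A_rem"
      "disjoint_family_on R {1..T}"
      "\<forall>j\<in>{1..T}. R j \<inter> A_rem = {} \<and> R j \<noteq> {} \<and> good (R j)" "sum f A_rem < t"
      by (elim exE conjE) (rule that)
    have [simp]: "{Suc 0..Suc T} = insert (Suc T) {Suc 0..T}" by auto
    \<comment> \<open>The first piece removed gets the last index, so the pieces from the induction
      hypothesis keep theirs.\<close>
    let ?R = "R(Suc T := R0)"
    have union: "(\<Union>j\<in>{1..Suc T}. ?R j) = R0 \<union> (\<Union>j\<in>{1..T}. R j)"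
      by (fastforce split: if_splits)
    have "x \<notin> R j" if "x \<in> R0" "j \<in> {1..T}" for x j
      using IH(1) that by blast
    then have "disjoint_family_on ?R {1..Suc T}"
      using IH(2) by (fastforce simp: disjoint_family_on_def)
    moreover have "A = (\<Union>j\<in>{1..Suc T}. ?R j) \<union> A_rem"
      unfolding union using IH(1) R0(1) by blast
    moreover have "R0 \<inter> A_rem = {}"
      using IH(1) by blast
    then have "\<forall>j\<in>{1..Suc T}. ?R j \<inter> A_rem = {} \<and> ?R j \<noteq> {} \<and> good (?R j)"
      using IH(3) R0 by auto
    ultimately show ?thesis using IH(4)
      by (intro exI[of _ "Suc T"] exI[of _ ?R] exI[of _ A_rem] conjI)
  qed
qed

text \<open>Double counting: the squared degree of \<open>p\<close> counts ordered pairs of spheres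
  through \<open>p\<close>, the diagonal pairs included.\<close>

lemma sum_sphere_degree_squared:
  fixes Q :: "'a::{field,finite} ^ 'n::finite \<Rightarrow> 'a"
  shows "(\<Sum>p\<in>M. (sphere_degree Q \<S> p)\<^sup>2)
       = (\<Sum>(s, s')\<in>\<S> \<times> \<S>. card (M \<inter> qsphere Q s \<inter> qsphere Q s'))"
proof -
  have deg: "sphere_degree Q \<S> p = (\<Sum>s\<in>\<S>. of_bool (p \<in> qsphere Q s))" for p
    by (simp add: sphere_degree_def Int_def)
  have "(\<Sum>p\<in>M. (sphere_degree Q \<S> p)\<^sup>2)
      = (\<Sum>p\<in>M. \<Sum>(s, s')\<in>\<S> \<times> \<S>. of_bool (p \<in> qsphere Q s \<inter> qsphere Q s'))"
    unfolding deg power2_eq_square sum_product sum.cartesian_product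
    by (simp add: of_bool_conj)
  also have "\<dots> = (\<Sum>(s, s')\<in>\<S> \<times> \<S>. card (M \<inter> qsphere Q s \<inter> qsphere Q s'))"
    by (subst sum.swap) (auto intro!: sum.cong arg_cong[where f = card])
  finally show ?thesis .
qed

text \<open>For a fixed center, \<open>Q (x - c)\<close> has only one value at \<open>x\<close>, so
  concentric spheres with a common point coincide. Only diagonal pairs contribute, and they count
  the incidences of \<open>M\<close> with \<S>.\<close>

lemma sum_concentric_pairs:
  fixes Q :: "'a::{field,finite} ^ 'n::finite \<Rightarrow> 'a"
  shows "(\<Sum>(s, s')\<in>{(s, s') \<in> \<S> \<times> \<S>. \<not> nonconcentric s s'}.
            card (M \<inter> qsphere Q s \<inter> qsphere Q s'))
       = (\<Sum>p\<in>M. sphere_degree Q \<S> p)"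
proof -
  have "(\<Sum>(s, s')\<in>{(s, s') \<in> \<S> \<times> \<S>. \<not> nonconcentric s s'}.
            card (M \<inter> qsphere Q s \<inter> qsphere Q s'))
      = (\<Sum>(s, s')\<in>(\<lambda>s. (s, s)) ` \<S>. card (M \<inter> qsphere Q s \<inter> qsphere Q s'))"
    by (rule sum.mono_neutral_right)
      (auto simp: nonconcentric_def qsphere_def intro!: arg_cong[where f = card])
  also have "\<dots> = (\<Sum>s\<in>\<S>. card (M \<inter> qsphere Q s))"
    by (subst sum.reindex) (auto simp: inj_on_def Int_assoc)
  also have "\<dots> = (\<Sum>s\<in>\<S>. \<Sum>p\<in>M. of_bool (p \<in> qsphere Q s))"
    by simp
  also have "\<dots> = (\<Sum>p\<in>M. sphere_degree Q \<S> p)"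
    by (subst sum.swap) (simp add: sphere_degree_def Int_def)
  finally show ?thesis .
qed

text \<open>Pigeonhole over at most \<open>(card \<S>)\<^sup>2\<close> pairs, with denominators
  cleared. The factor 2 pays for the concentric pairs.\<close>

lemma exists_rich_nonconcentric_pair:
  fixes Q :: "'a::{field,finite} ^ 'n::finite \<Rightarrow> 'a"
    and M :: "('a ^ 'n) set" and \<S> :: "(('a ^ 'n) \<times> 'a) set"
  defines "D \<equiv> real (\<Sum>p\<in>M. sphere_degree Q \<S> p)"
  assumes "M \<noteq> {}" and D: "2 * real (card M) \<le> D"
  shows "\<exists>s\<in>\<S>. \<exists>s'\<in>\<S>. nonconcentric s s' \<and>
           D\<^sup>2 \<le> 2 * real (card M) * (real (card \<S>))\<^sup>2 * real (card (M \<inter> qsphere Q s \<inter> qsphere Q s'))"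
proof (rule ccontr)
  assume contra: "\<not> ?thesis"
  define g where "g = (\<lambda>(s, s'). card (M \<inter> qsphere Q s \<inter> qsphere Q s'))"
  define N where "N = {(s, s') \<in> \<S> \<times> \<S>. nonconcentric s s'}"
  define m where "m = real (card M)"
  have m: "m > 0" using \<open>M \<noteq> {}\<close> by (simp add: m_def card_gt_0_iff)
  have Dm: "2 * m \<le> D" using D by (simp add: m_def)
  \<comment> \<open>Cauchy-Schwarz against the constant function 1.\<close>
  have "D\<^sup>2 \<le> m * (\<Sum>p\<in>M. (real (sphere_degree Q \<S> p))\<^sup>2)"
    using Cauchy_Schwarz_ineq_sum[of "\<lambda>_. 1" "\<lambda>p. real (sphere_degree Q \<S> p)" M]
    by (simp add: D_def m_def)
  also have "(\<Sum>p\<in>M. (real (sphere_degree Q \<S> p))\<^sup>2) = real (sum g (\<S> \<times> \<S>))"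
    by (simp add: g_def flip: sum_sphere_degree_squared)
  also have "sum g (\<S> \<times> \<S>) = sum g N + sum g {(s, s') \<in> \<S> \<times> \<S>. \<not> nonconcentric s s'}"
    by (subst sum.union_disjoint[symmetric]) (auto simp: N_def intro!: sum.cong)
  also have "real \<dots> = real (sum g N) + D"
    unfolding g_def D_def sum_concentric_pairs by simp
  finally have "D\<^sup>2 \<le> m * real (sum g N) + m * D" by (simp add: distrib_left)
  moreover have "2 * (m * D) \<le> D\<^sup>2"
    \<comment> \<open>Since \<open>2 * m \<le> D\<close>, the concentric term \<open>m * D\<close>
      takes at most half of \<open>D\<^sup>2\<close>.\<close>
    using Dm m by (simp add: power2_eq_square mult_right_mono flip: mult.assoc)
  ultimately have lower: "D\<^sup>2 \<le> 2 * m * real (sum g N)" by simp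
  have D2: "0 < D\<^sup>2" using Dm m by simp
  \<comment> \<open>Nonemptiness of \<open>N\<close> makes the termwise strict bound below strict
    for the sum.\<close>
  then have "N \<noteq> {}" using lower by auto
  have "card N \<le> card (\<S> \<times> \<S>)"
    by (intro card_mono) (auto simp: N_def)
  then have cNS: "real (card N) \<le> (real (card \<S>))\<^sup>2"
    by (simp add: card_cartesian_product power2_eq_square flip: of_nat_mult)
  have upper: "2 * m * (real (card \<S>))\<^sup>2 * real (g x) < D\<^sup>2" if "x \<in> N" for x
    using contra that by (force simp: N_def g_def m_def)
  have "(real (card \<S>))\<^sup>2 * D\<^sup>2 \<le> (\<Sum>x\<in>N. 2 * m * (real (card \<S>))\<^sup>2 * real (g x))"
    using mult_left_mono[OF lower, of "(real (card \<S>))\<^sup>2"]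
    by (simp add: sum_distrib_left mult_ac)
  also have "\<dots> < (\<Sum>x\<in>N. D\<^sup>2)"
    using upper \<open>N \<noteq> {}\<close> by (intro sum_strict_mono) auto
  also have "\<dots> \<le> (real (card \<S>))\<^sup>2 * D\<^sup>2"
    using cNS D2 by (simp add: mult_right_mono)
  finally show False by simp
qed

text \<open>One greedy step: \<open>A\<close> is the current remainder and \<open>c\<close> stands
  for \<epsilon> K q^((d-1)/2). The hypotheses and the size bound refer to \<open>P\<close> and
  \<S>, not to \<open>A\<close>, so the guaranteed size does not decay as the remainder
  shrinks.\<close>

lemma exists_rich_positive_piece:
  fixes Q :: "'a::{field,finite} ^ 'n::finite \<Rightarrow> 'a"
  assumes "A \<subseteq> P" and "\<S> \<noteq> {}" and "c > 0"
    and surplus: "c * sqrt (real (card P) * real (card \<S>)) \<le> (\<Sum>p\<in>A. excess Q \<S> p)"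
    and size: "4 * real (card P) \<le> c\<^sup>2 * real (card \<S>)"
    and "P \<noteq> {}"
  shows "\<exists>R\<subseteq>A. c\<^sup>2 / (4 * real (card \<S>)) \<le> real (card R) \<and>
           (\<exists>s\<in>\<S>. \<exists>s'\<in>\<S>. nonconcentric s s' \<and>
              R \<subseteq> pos_points Q P \<S> \<inter> qsphere Q s \<inter> qsphere Q s')"
proof -
  define M where "M = {p \<in> A. excess Q \<S> p > 0}"
  define D where "D = real (\<Sum>p\<in>M. sphere_degree Q \<S> p)"
  define W where "W = c * sqrt (real (card P) * real (card \<S>))"
  define n where "n = real (card \<S>)"
  have n: "n > 0" using \<open>\<S> \<noteq> {}\<close> by (simp add: n_def card_gt_0_iff)
  have p: "real (card P) > 0" using \<open>P \<noteq> {}\<close> by (simp add: card_gt_0_iff)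
  have W: "W > 0" using n p \<open>c > 0\<close> by (simp add: W_def n_def)
  \<comment> \<open>Dropping points of nonpositive excess cannot lower the sum, and each excess is
    at most the degree.\<close>
  have "(\<Sum>p\<in>A. excess Q \<S> p) \<le> (\<Sum>p\<in>M. excess Q \<S> p)"
    using sum_mono2[of A M "\<lambda>p. - excess Q \<S> p"] by (force simp: M_def sum_negf)
  also have "\<dots> \<le> D"
    by (auto simp: D_def excess_def intro!: sum_mono)
  finally have WD: "W \<le> D" using surplus by (simp add: W_def)
  have "M \<noteq> {}" using W WD by (auto simp: D_def)
  have "M \<subseteq> P" using \<open>A \<subseteq> P\<close> by (auto simp: M_def)
  then have mp: "real (card M) \<le> real (card P)" by (simp add: card_mono)
  have Wsq: "W\<^sup>2 = c\<^sup>2 * real (card P) * n"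
    by (simp add: W_def n_def power_mult_distrib)
  \<comment> \<open>The size hypothesis times \<open>card P\<close> gives
    \<open>2 * card P \<le> W\<close>; with \<open>card M \<le> card P\<close> and
    \<open>W \<le> D\<close> this is the degree condition of the rich pair lemma.\<close>
  have "(2 * real (card P))\<^sup>2 = 4 * real (card P) * real (card P)"
    by (simp add: power2_eq_square)
  also have "\<dots> \<le> c\<^sup>2 * n * real (card P)"
    unfolding n_def by (rule mult_right_mono[OF size]) simp
  finally have "(2 * real (card P))\<^sup>2 \<le> W\<^sup>2"
    by (simp add: Wsq mult_ac)
  then have "2 * real (card P) \<le> W"
    by (rule power2_le_imp_le) (use W in simp)
  then have "2 * real (card M) \<le> real (\<Sum>p\<in>M. sphere_degree Q \<S> p)"
    using mp WD by (simp add: D_def)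
  from exists_rich_nonconcentric_pair[OF \<open>M \<noteq> {}\<close> this]
  obtain s s' where s: "s \<in> \<S>" "s' \<in> \<S>" "nonconcentric s s'"
    and rich: "D\<^sup>2 \<le> 2 * real (card M) * n\<^sup>2 * real (card (M \<inter> qsphere Q s \<inter> qsphere Q s'))"
    by (auto simp: D_def n_def)
  define R where "R = M \<inter> qsphere Q s \<inter> qsphere Q s'"
  have "c\<^sup>2 * real (card P) * n \<le> D\<^sup>2"
    using WD W by (simp flip: Wsq)
  \<comment> \<open>Enlarging \<open>card M\<close> to \<open>card P\<close> lets the common
    positive factor \<open>card P * n\<close> cancel.\<close>
  also have "\<dots> \<le> 2 * real (card P) * n\<^sup>2 * real (card R)"
    using rich mult_right_mono[OF mp, of "2 * n\<^sup>2 * real (card R)"]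
    by (simp add: R_def mult_ac)
  finally have "c\<^sup>2 * (real (card P) * n) \<le> 2 * n * real (card R) * (real (card P) * n)"
    by (simp add: power2_eq_square mult_ac)
  then have "c\<^sup>2 \<le> 2 * n * real (card R)"
    using n p by (simp add: mult_ac)
  \<comment> \<open>The argument gives \<open>c\<^sup>2 / (2 * n)\<close>; the stated 4 gives away a
    factor of two.\<close>
  also have "\<dots> \<le> real (card R) * (4 * n)"
    using n by simp
  finally have "c\<^sup>2 / (4 * n) \<le> real (card R)"
    using n by (simp add: pos_divide_le_eq)
  moreover have "R \<subseteq> A" "R \<subseteq> pos_points Q P \<S> \<inter> qsphere Q s \<inter> qsphere Q s'"
    using \<open>A \<subseteq> P\<close> by (auto simp: R_def M_def pos_points_def)
  ultimately show ?thesis using s by (auto simp: n_def)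
qed

theorem theorem3p9:
  fixes Q :: "'a::{field,finite} ^ 'n::finite \<Rightarrow> 'a"
    and P :: "('a ^ 'n) set"
    and \<S> :: "(('a ^ 'n) \<times> 'a) set"
    and K \<epsilon> :: real
  defines "q \<equiv> CARD('a)" and "d \<equiv> CARD('n)"
  assumes "odd q" and "d \<ge> 2"
    and "quadratic_form Q" and "nondegenerate Q"
    and "P \<noteq> {}" and "\<S> \<noteq> {}" and "K > 0"
    and "surplus Q P \<S> \<ge>
           K * real q powr ((real d - 1) / 2) * sqrt (real (card P) * real (card \<S>))"
    and "0 < \<epsilon>" and "\<epsilon> \<le> 1"
    and "\<epsilon>\<^sup>2 * K\<^sup>2 * real q ^ (d - 1) * real (card \<S>) \<ge> 4 * real (card P)"
  shows "\<exists>(T::nat) (R :: nat \<Rightarrow> ('a ^ 'n) set) P_rem.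
      P = (\<Union>j\<in>{1..T}. R j) \<union> P_rem \<and>
      disjoint_family_on R {1..T} \<and>
      (\<forall>j\<in>{1..T}. R j \<inter> P_rem = {}) \<and>
      (\<forall>j\<in>{1..T}.
         (\<exists>s\<in>\<S>. \<exists>s'\<in>\<S>. nonconcentric s s' \<and>
            R j \<subseteq> pos_points Q P \<S> \<inter> qsphere Q s \<inter> qsphere Q s') \<and>
         real (card (R j)) \<ge> \<epsilon>\<^sup>2 * K\<^sup>2 * real q ^ (d - 1) / (4 * real (card \<S>))) \<and>
      (\<forall>j\<in>{1..T}. (\<Sum>p\<in>R j. excess Q \<S> p) > 0) \<and>
      real T \<le> 4 * real (card P) * real (card \<S>) / (\<epsilon>\<^sup>2 * K\<^sup>2 * real q ^ (d - 1)) \<and>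
      (\<Sum>p\<in>P_rem. excess Q \<S> p) < \<epsilon> * surplus Q P \<S> \<and>
      (\<Sum>j = 1..T. \<Sum>p\<in>R j. excess Q \<S> p) > (1 - \<epsilon>) * surplus Q P \<S> \<and>
      (\<forall>C\<^sub>1::real. real (card \<S>) \<le> C\<^sub>1 * K * real q powr ((real d - 1) / 2) \<longrightarrow>
         (\<forall>j\<in>{1..T}.
            real (card (R j)) \<ge> \<epsilon>\<^sup>2 * K * real q powr ((real d - 1) / 2) / (4 * C\<^sub>1)))"
proof -
  define X where "X = real q powr ((real d - 1) / 2)"
  define c where "c = \<epsilon> * K * X"
  define n where "n = real (card \<S>)"
  define L where "L = c\<^sup>2 / (4 * n)"
  have "X > 0" by (simp add: X_def q_def)
  \<comment> \<open>As \<open>d \<ge> 2\<close>, the real exponent d - 1 agrees with the truncated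
    natural one, so \<open>X\<close> is a square root of \<open>q ^ (d - 1)\<close>.\<close>
  have "real q powr (real d - 1) = real q powr real (d - 1)"
    using \<open>d \<ge> 2\<close> by (simp add: of_nat_diff)
  also have "\<dots> = real q ^ (d - 1)"
    by (rule powr_realpow) (simp add: q_def)
  finally have X2: "X\<^sup>2 = real q ^ (d - 1)"
    by (simp add: X_def power2_eq_square flip: powr_add)
  have c2: "\<epsilon>\<^sup>2 * K\<^sup>2 * real q ^ (d - 1) = c\<^sup>2"
    by (simp add: c_def power_mult_distrib X2)
  have "c > 0" using \<open>X > 0\<close> \<open>K > 0\<close> \<open>0 < \<epsilon>\<close> by (simp add: c_def)
  have "n > 0" using \<open>\<S> \<noteq> {}\<close> by (simp add: n_def card_gt_0_iff)
  have "L > 0" using \<open>c > 0\<close> \<open>n > 0\<close> by (simp add: L_def)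
  have size: "4 * real (card P) \<le> c\<^sup>2 * real (card \<S>)"
    using assms(13) unfolding c2 .
  have "K * X * sqrt (real (card P) * real (card \<S>)) \<le> surplus Q P \<S>"
    using assms(10) by (simp add: X_def)
  then have sur: "c * sqrt (real (card P) * real (card \<S>)) \<le> \<epsilon> * surplus Q P \<S>"
    using \<open>0 < \<epsilon>\<close> by (simp add: c_def mult.assoc)
  define good where "good R \<longleftrightarrow> L \<le> real (card R) \<and> (\<exists>s\<in>\<S>. \<exists>s'\<in>\<S>. nonconcentric s s' \<and>
      R \<subseteq> pos_points Q P \<S> \<inter> qsphere Q s \<inter> qsphere Q s')" for R
  have "\<forall>B\<subseteq>P. \<epsilon> * surplus Q P \<S> \<le> sum (excess Q \<S>) B \<longrightarrow> (\<exists>R\<subseteq>B. R \<noteq> {} \<and> good R)"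
  proof (intro allI impI)
    fix B assume B: "B \<subseteq> P" "\<epsilon> * surplus Q P \<S> \<le> sum (excess Q \<S>) B"
    obtain R where "R \<subseteq> B" "good R"
      using exists_rich_positive_piece[OF B(1) \<open>\<S> \<noteq> {}\<close> \<open>c > 0\<close> order_trans[OF sur B(2)] size \<open>P \<noteq> {}\<close>]
      by (auto simp: good_def L_def n_def)
    \<comment> \<open>The threshold \<open>L\<close> is positive, so a good piece is nonempty, as
      the extraction requires.\<close>
    moreover have "R \<noteq> {}" using \<open>good R\<close> \<open>L > 0\<close> by (auto simp: good_def)
    ultimately show "\<exists>R\<subseteq>B. R \<noteq> {} \<and> good R" by blast
  qed
  from greedy_extraction[OF finite this]
  obtain T :: nat and R P_rem where P: "P = (\<Union>j\<in>{1..T}. R j) \<union> P_rem"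
    and disj: "disjoint_family_on R {1..T}"
    and R: "\<forall>j\<in>{1..T}. R j \<inter> P_rem = {} \<and> R j \<noteq> {} \<and> good (R j)"
    and rem: "sum (excess Q \<S>) P_rem < \<epsilon> * surplus Q P \<S>"
    by (elim exE conjE) (rule that)
  have pos: "\<forall>j\<in>{1..T}. (\<Sum>p\<in>R j. excess Q \<S> p) > 0"
  proof
    fix j assume "j \<in> {1..T}"
    then show "(\<Sum>p\<in>R j. excess Q \<S> p) > 0"
      using R by (intro sum_pos) (auto simp: good_def pos_points_def)
  qed
  \<comment> \<open>Kept general in \<open>g\<close>: it serves for the excess and, with
    \<open>g = 1\<close>, for counting points.\<close>
  have union: "sum g (\<Union>j\<in>{1..T}. R j) = (\<Sum>j = 1..T. sum g (R j))" for g :: "'a ^ 'n \<Rightarrow> real"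
    using disj by (intro sum.UNION_disjoint) (auto simp: disjoint_family_on_def)
  have "surplus Q P \<S> = (\<Sum>p\<in>(\<Union>j\<in>{1..T}. R j) \<union> P_rem. excess Q \<S> p)"
    using P by (simp add: surplus_eq_sum_excess)
  also have "\<dots> = (\<Sum>p\<in>(\<Union>j\<in>{1..T}. R j). excess Q \<S> p) + (\<Sum>p\<in>P_rem. excess Q \<S> p)"
    using R by (intro sum.union_disjoint) auto
  finally have main: "(\<Sum>j = 1..T. \<Sum>p\<in>R j. excess Q \<S> p) > (1 - \<epsilon>) * surplus Q P \<S>"
    unfolding union left_diff_distrib mult_1_left using rem by linarith
  \<comment> \<open>Disjoint pieces with at least \<open>L\<close> points each fit into
    \<open>P\<close>, which bounds their number by \<open>card P / L\<close>.\<close>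
  have "real T * L = (\<Sum>j = 1..T. L)" by simp
  also have "\<dots> \<le> (\<Sum>j = 1..T. \<Sum>p\<in>R j. 1)"
    using R by (intro sum_mono) (simp add: good_def)
  also have "\<dots> = real (card (\<Union>j\<in>{1..T}. R j))"
    by (subst union[symmetric]) simp
  also have "\<dots> \<le> real (card P)"
    using P by (intro of_nat_mono card_mono) auto
  finally have "real T \<le> real (card P) / L"
    using \<open>L > 0\<close> by (simp add: le_divide_eq)
  then have T: "real T \<le> 4 * real (card P) * real (card \<S>) / c\<^sup>2"
    by (simp add: L_def n_def mult_ac)
  have last: "\<epsilon>\<^sup>2 * K * X / (4 * C) \<le> L" if C: "real (card \<S>) \<le> C * K * X" for C
  proof -
    \<comment> \<open>The sign of \<open>C\<close> is not assumed: it is forced by 0 <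
      \<open>card \<S>\<close> \<le> \<open>C * K * X\<close>. Replacing \<open>card \<S>\<close> in
      \<open>L\<close> by this upper bound then cancels one factor \<open>K * X\<close> of
      \<open>c\<^sup>2\<close>.\<close>
    have "0 < C * (K * X)" using C \<open>n > 0\<close> by (simp add: n_def mult.assoc)
    then have "C > 0" using \<open>K > 0\<close> \<open>X > 0\<close> zero_less_mult_pos2 mult_pos_pos by blast
    have "\<epsilon>\<^sup>2 * K * X / (4 * C) = c\<^sup>2 / (4 * (C * K * X))"
      using \<open>C > 0\<close> \<open>K > 0\<close> \<open>X > 0\<close> by (simp add: c_def field_simps power2_eq_square)
    also have "\<dots> \<le> L"
      unfolding L_def using C \<open>n > 0\<close> \<open>C > 0\<close> \<open>K > 0\<close> \<open>X > 0\<close>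
      by (intro divide_left_mono) (auto simp: n_def)
    finally show ?thesis .
  qed
  have rich: "\<forall>j\<in>{1..T}. (\<exists>s\<in>\<S>. \<exists>s'\<in>\<S>. nonconcentric s s' \<and>
      R j \<subseteq> pos_points Q P \<S> \<inter> qsphere Q s \<inter> qsphere Q s') \<and>
      c\<^sup>2 / (4 * real (card \<S>)) \<le> real (card (R j))"
    using R unfolding good_def L_def n_def by blast
  have "\<forall>C. real (card \<S>) \<le> C * K * X \<longrightarrow>
      (\<forall>j\<in>{1..T}. \<epsilon>\<^sup>2 * K * X / (4 * C) \<le> real (card (R j)))"
    using R last unfolding good_def by (meson order_trans)
  moreover have "\<forall>j\<in>{1..T}. R j \<inter> P_rem = {}" using R by blast
  ultimately show ?thesis
    unfolding c2 X_def[symmetric] using P disj rich pos T rem main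
    by (intro exI[of _ T] exI[of _ R] exI[of _ P_rem] conjI)
qed

end
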